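(* Let $\Omega$ be a nonempty set and $k:\Omega\times\Omega\to\mathbb{R}$ a positive definite kernel with reproducing kernel Hilbert space $\mathcal{H}_k(\Omega)$. Let $m_p,m_q,n_p,n_q\in\mathbb{N}_0$ with $m_p\ge n_p$, $m_q\ge n_q$, let $\lambda_p\in(\mathcal{H}_k(\Omega)')^{m_p}$, $\lambda_q\in(\mathcal{H}_k(\Omega)')^{m_q}$, $r_p\in\mathbb{R}^{n_p}$, $r_q\in\mathbb{R}^{n_q}$, let $p:\mathbb{R}^{m_p}\to\mathbb{R}^{n_p}$ and $q:\mathbb{R}^{m_q}\to\mathbb{R}^{n_q}$ be continuous, and assume that the components of $\Lambda:=[\lambda_p^\top\ \lambda_q^\top]^\top$ are linearly independent and that there is $\bar s\in\mathcal{H}_k(\Omega)$ with $p(\lambda_p(\bar s))=r_p$ and $q(\lambda_q(\bar s))\ge r_q$. Suppose $p$ has the partially affine form $$p(z_p)=z_{p,0}+\tilde p(z_{\tilde p}),\qquad z_p=\begin{bmatrix} z_{p,0} \\ z_{\tilde p} \end{bmatrix},\quad z_{p,0}\in\mathbb{R}^{n_p},\ z_{\tilde p}\in\mathbb{R}^{m_p-n_p},$$ with $\tilde p\in C^1(\mathbb{R}^{m_p-n_p},\mathbb{R}^{n_p})$ and Jacobian $J_{\tilde p}$, and write accordingly $\lambda_p=[\lambda_{p,0}^\top\ \lambda_{\tilde p}^\top]^\top$ with $\lambda_{p,0}\in(\mathcal{H}_k(\Omega)')^{n_p}$, $\lambda_{\tilde p}\in(\mathcal{H}_k(\Omega)')^{m_p-n_p}$.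 Given $s^{\mathrm{old}}\in\mathcal{H}_k(\Omega)$, set $z_{\tilde p}^{\mathrm{old}}:=\lambda_{\tilde p}(s^{\mathrm{old}})$, $z_q^{\mathrm{old}}:=\lambda_q(s^{\mathrm{old}})$, and $$\lambda^{\mathrm{lin}}_{s^{\mathrm{old}}}:=\lambda_{p,0}+J_{\tilde p}(z_{\tilde p}^{\mathrm{old}})\lambda_{\tilde p}\in(\mathcal{H}_k(\Omega)')^{n_p},\qquad b^{\mathrm{old}}:=r_p-\tilde p(z_{\tilde p}^{\mathrm{old}})+J_{\tilde p}(z_{\tilde p}^{\mathrm{old}})z_{\tilde p}^{\mathrm{old}}\in\mathbb{R}^{n_p}.$$ Then the Gauss-Newton subproblem $$\text{(GN)}\quad\min_{\Delta z_{\tilde p}\in\mathbb{R}^{m_p-n_p},\,\Delta z_q\in\mathbb{R}^{m_q}}\left\|\begin{bmatrix} r_p-\tilde p(z_{\tilde p}^{\mathrm{old}}) \\ z_{\tilde p}^{\mathrm{old}} \\ z_q^{\mathrm{old}} \end{bmatrix}+\begin{bmatrix} -J_{\tilde p}(z_{\tilde p}^{\mathrm{old}}) & 0 \\ I_{m_p-n_p} & 0 \\ 0 & I_{m_q} \end{bmatrix}\begin{bmatrix} \Delta z_{\tilde p} \\ \Delta z_q \end{bmatrix}\right\|^2_{\mathcal{K}_\Lambda^{-1}}\quad\text{s.t.}\quad q(z_q^{\mathrm{old}}+\Delta z_q)\ge r_q$$ is equivalent to the infinite-dimensional linear optimal recovery problem $$\text{(L)}\quad \min_{s\in\mathcal{H}_k(\Omega)}\|s\|_{\mathcal{H}_k(\Omega)}\quad\text{s.t.}\quad\lambda^{\mathrm{lin}}_{s^{\mathrm{old}}}(s)=b^{\mathrm{old}},\quad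 q(\lambda_q(s))\ge r_q,$$ in the following sense: if $(\Delta z_{\tilde p},\Delta z_q)$ solves (GN), then with $z_{\tilde p}=z_{\tilde p}^{\mathrm{old}}+\Delta z_{\tilde p}$, $z_q=z_q^{\mathrm{old}}+\Delta z_q$ and $z_{p,0}=b^{\mathrm{old}}-J_{\tilde p}(z_{\tilde p}^{\mathrm{old}})z_{\tilde p}$, the unique minimal-norm element $s\in\mathcal{H}_k(\Omega)$ with $\lambda_{p,0}(s)=z_{p,0}$, $\lambda_{\tilde p}(s)=z_{\tilde p}$, $\lambda_q(s)=z_q$ is a minimizer of (L); conversely, if $s^*_{\mathrm{GN}}$ minimizes (L), then $\Delta z_{\tilde p}=\lambda_{\tilde p}(s^*_{\mathrm{GN}})-z_{\tilde p}^{\mathrm{old}}$ and $\Delta z_q=\lambda_q(s^*_{\mathrm{GN}})-z_q^{\mathrm{old}}$ solve (GN). Moreover, the components of $\lambda^{\mathrm{lin}}_{s^{\mathrm{old}}}$ and $\lambda_q$ are (jointly) linearly independent.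
   Context: A kernel is a symmetric function $k:\Omega\times\Omega\to\mathbb{R}$; it is positive definite if for every finite set of pairwise distinct points $x_1,\dots,x_n\in\Omega$ the matrix $(k(x_i,x_j))_{i,j}$ is positive semidefinite. $\mathcal{H}_k(\Omega)$ is the unique Hilbert space of real-valued functions on $\Omega$ with reproducing kernel $k$, and $\mathcal{H}_k(\Omega)'$ is its dual. For a vector of functionals $\lambda=[\lambda_1\ \dots\ \lambda_m]$ one writes $\lambda(s)=[\lambda_1(s)\ \dots\ \lambda_m(s)]^\top\in\mathbb{R}^m$; a real matrix times a vector of functionals is formed in the obvious way. Inequalities between vectors are componentwise. $I_d$ denotes the $d\times d$ identity matrix. $\|y\|_A:=\sqrt{\langle y,Ay\rangle}$ for symmetric positive definite $A$. For $\Lambda$ with components having Riesz representers $w_1,\dots,w_m\in\mathcal{H}_k(\Omega)$ ($m=m_p+m_q$), the generalized Gramian is $\mathcal{K}_\Lambda:=(\langle w_i,w_j\rangle_{\mathcal{H}_k(\Omega)})_{i,j=1}^{m}$, which is symmetric positive definite when the components of $\Lambda$ are linearly independent. *)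

theory Defs
  imports
    "HOL-Library.Function_Algebras"
    "HOL-Analysis.Abstract_Euclidean_Space"
    "HOL-Analysis.Derivative"
    "Jordan_Normal_Form.Gauss_Jordan_Elimination"
begin

text \<open>
  All dimensions are natural numbers and may be zero, so vectors and matrices are those of
  \<^theory>\<open>Jordan_Normal_Form.Matrix\<close>; \<open>carrier_vec n\<close> plays the role of n-dimensional real
  space, and the order on vectors is componentwise.
\<close>

type_synonym rvec = "real Matrix.vec"
type_synonym rmat = "real Matrix.mat"


section \<open>Kernels and their reproducing kernel Hilbert spaces\<close>

definition pos_def_kernel :: "'a set \<Rightarrow> ('a \<Rightarrow> 'a \<Rightarrow> real) \<Rightarrow> bool" where
  "pos_def_kernel \<Omega> k \<longleftrightarrow>
     (\<forall>x\<in>\<Omega>. \<forall>y\<in>\<Omega>. k x y = k y x) \<and>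
     (\<forall>X c. finite X \<and> X \<subseteq> \<Omega> \<longrightarrow> 0 \<le> (\<Sum>x\<in>X. \<Sum>y\<in>X. c x * k x y * c y))"

definition hnorm :: "('h \<Rightarrow> 'h \<Rightarrow> real) \<Rightarrow> 'h \<Rightarrow> real" where
  "hnorm ip f = sqrt (ip f f)"

text \<open>
  A real-valued function on \<open>\<Omega>\<close> is encoded as a function on the whole type that vanishes outside
  \<open>\<Omega>\<close>, so that equality of functions on \<open>\<Omega>\<close> is equality in HOL and the linear structure is
  pointwise. Values of the inner product \<open>ip\<close> outside \<open>H\<close> are irrelevant.
\<close>

locale hilbert_function_space =
  fixes \<Omega> :: "'a set" and H :: "('a \<Rightarrow> real) set"
    and ip :: "('a \<Rightarrow> real) \<Rightarrow> ('a \<Rightarrow> real) \<Rightarrow> real"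
  assumes vanish: "f \<in> H \<Longrightarrow> x \<notin> \<Omega> \<Longrightarrow> f x = 0"
    and zero_mem: "0 \<in> H"
    and add_mem: "f \<in> H \<Longrightarrow> g \<in> H \<Longrightarrow> f + g \<in> H"
    and scale_mem: "f \<in> H \<Longrightarrow> (\<lambda>x. c * f x) \<in> H"
    and ip_commute: "f \<in> H \<Longrightarrow> g \<in> H \<Longrightarrow> ip f g = ip g f"
    and ip_add: "f \<in> H \<Longrightarrow> g \<in> H \<Longrightarrow> h \<in> H \<Longrightarrow> ip (f + g) h = ip f h + ip g h"
    and ip_scale: "f \<in> H \<Longrightarrow> g \<in> H \<Longrightarrow> ip (\<lambda>x. c * f x) g = c * ip f g"
    and ip_nonneg: "f \<in> H \<Longrightarrow> 0 \<le> ip f f"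
    and ip_definite: "f \<in> H \<Longrightarrow> ip f f = 0 \<Longrightarrow> f = 0"
    and complete:
      "(\<And>n. F n \<in> H) \<Longrightarrow>
       (\<And>e. e > 0 \<Longrightarrow> \<exists>N. \<forall>m\<ge>N. \<forall>n\<ge>N. hnorm ip (F m - F n) < e) \<Longrightarrow>
       \<exists>f\<in>H. (\<lambda>n. hnorm ip (F n - f)) \<longlonglongrightarrow> 0"

text \<open>
  The reproducing kernel Hilbert space of \<open>k\<close> on \<open>\<Omega>\<close>, as a property of the pair \<open>(H, ip)\<close>; it
  determines \<open>H\<close>, and \<open>ip\<close> on \<open>H\<close>.
\<close>

locale rkhs = hilbert_function_space \<Omega> H ip
  for \<Omega> :: "'a set" and k :: "'a \<Rightarrow> 'a \<Rightarrow> real" and H :: "('a \<Rightarrow> real) set"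
    and ip :: "('a \<Rightarrow> real) \<Rightarrow> ('a \<Rightarrow> real) \<Rightarrow> real" +
  assumes kernel_mem: "x \<in> \<Omega> \<Longrightarrow> (\<lambda>y. if y \<in> \<Omega> then k y x else 0) \<in> H"
    and reproducing: "x \<in> \<Omega> \<Longrightarrow> f \<in> H \<Longrightarrow> ip f (\<lambda>y. if y \<in> \<Omega> then k y x else 0) = f x"


section \<open>Vectors of functionals\<close>

type_synonym 'a functional = "('a \<Rightarrow> real) \<Rightarrow> real"

text \<open>Only the restriction of a functional to \<open>H\<close> is meaningful.\<close>

definition dual ::
  "('a \<Rightarrow> real) set \<Rightarrow> (('a \<Rightarrow> real) \<Rightarrow> ('a \<Rightarrow> real) \<Rightarrow> real) \<Rightarrow> 'a functional set" where
  "dual H ip = {L.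
     (\<forall>f\<in>H. \<forall>g\<in>H. L (f + g) = L f + L g) \<and>
     (\<forall>f\<in>H. \<forall>c. L (\<lambda>x. c * f x) = c * L f) \<and>
     (\<exists>C. \<forall>f\<in>H. \<bar>L f\<bar> \<le> C * hnorm ip f)}"

definition dual_vec ::
  "('a \<Rightarrow> real) set \<Rightarrow> (('a \<Rightarrow> real) \<Rightarrow> ('a \<Rightarrow> real) \<Rightarrow> real) \<Rightarrow> nat \<Rightarrow>
   'a functional Matrix.vec set" where
  "dual_vec H ip m = {L \<in> carrier_vec m. \<forall>i<m. L $ i \<in> dual H ip}"

definition apply_vec :: "'a functional Matrix.vec \<Rightarrow> ('a \<Rightarrow> real) \<Rightarrow> rvec" where
  "apply_vec L s = map_vec (\<lambda>l. l s) L"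

definition mat_functionals ::
  "rmat \<Rightarrow> 'a functional Matrix.vec \<Rightarrow> 'a functional Matrix.vec" where
  "mat_functionals A L =
     Matrix.vec (dim_row A) (\<lambda>i s. \<Sum>j<dim_vec L. A $$ (i, j) * (L $ j) s)"

definition lin_indep_on :: "('a \<Rightarrow> real) set \<Rightarrow> 'a functional Matrix.vec \<Rightarrow> bool" where
  "lin_indep_on H L \<longleftrightarrow>
     (\<forall>c::nat \<Rightarrow> real. (\<forall>s\<in>H. (\<Sum>i<dim_vec L. c i * (L $ i) s) = 0) \<longrightarrow>
        (\<forall>i<dim_vec L. c i = 0))"

definition riesz ::
  "('a \<Rightarrow> real) set \<Rightarrow> (('a \<Rightarrow> real) \<Rightarrow> ('a \<Rightarrow> real) \<Rightarrow> real) \<Rightarrow>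
   'a functional \<Rightarrow> ('a \<Rightarrow> real)" where
  "riesz H ip l = (THE w. w \<in> H \<and> (\<forall>f\<in>H. l f = ip f w))"

definition gramian ::
  "('a \<Rightarrow> real) set \<Rightarrow> (('a \<Rightarrow> real) \<Rightarrow> ('a \<Rightarrow> real) \<Rightarrow> real) \<Rightarrow>
   'a functional Matrix.vec \<Rightarrow> rmat" where
  "gramian H ip L = Matrix.mat (dim_vec L) (dim_vec L)
     (\<lambda>(i, j). ip (riesz H ip (L $ i)) (riesz H ip (L $ j)))"

text \<open>Unspecified if \<open>A\<close> is singular; only used for positive definite \<open>A\<close>.\<close>

definition inverse_mat :: "rmat \<Rightarrow> rmat" where
  "inverse_mat A = the (mat_inverse A)"

definition weighted_norm :: "rmat \<Rightarrow> rvec \<Rightarrow> real" where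
  "weighted_norm A y = sqrt (scalar_prod y (A *\<^sub>v y))"


section \<open>Continuity and continuous differentiability\<close>

text \<open>
  \<open>Euclidean_space m\<close> consists of the real sequences vanishing from index \<open>m\<close> on; it is identified
  with \<open>carrier_vec m\<close>.
\<close>

definition continuous_vec_fun :: "nat \<Rightarrow> nat \<Rightarrow> (rvec \<Rightarrow> rvec) \<Rightarrow> bool" where
  "continuous_vec_fun m n f \<longleftrightarrow>
     f \<in> carrier_vec m \<rightarrow> carrier_vec n \<and>
     continuous_map (Euclidean_space m) (Euclidean_space n)
       (\<lambda>z i. if i < n then f (Matrix.vec m z) $ i else 0)"

definition slice :: "(rvec \<Rightarrow> rvec) \<Rightarrow> rvec \<Rightarrow> nat \<Rightarrow> nat \<Rightarrow> real \<Rightarrow> real" where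
  "slice f z i j t = f (Matrix.vec (dim_vec z) (\<lambda>l. if l = j then t else z $ l)) $ i"

definition jacobian :: "nat \<Rightarrow> (rvec \<Rightarrow> rvec) \<Rightarrow> rvec \<Rightarrow> rmat" where
  "jacobian n f z = Matrix.mat n (dim_vec z) (\<lambda>(i, j). deriv (slice f z i j) (z $ j))"

definition C1_vec_fun :: "nat \<Rightarrow> nat \<Rightarrow> (rvec \<Rightarrow> rvec) \<Rightarrow> bool" where
  "C1_vec_fun m n f \<longleftrightarrow>
     f \<in> carrier_vec m \<rightarrow> carrier_vec n \<and>
     (\<forall>z\<in>carrier_vec m. \<forall>i<n. \<forall>j<m. slice f z i j differentiable at (z $ j)) \<and>
     (\<forall>i<n. \<forall>j<m. continuous_map (Euclidean_space m) euclideanreal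
        (\<lambda>z. jacobian n f (Matrix.vec m z) $$ (i, j)))"


section \<open>The two optimization problems\<close>

definition gn_matrix :: "rmat \<Rightarrow> nat \<Rightarrow> rmat" where
  "gn_matrix J m\<^sub>q = four_block_mat
     ((- J) @\<^sub>r 1\<^sub>m (dim_col J))          (0\<^sub>m (dim_row J + dim_col J) m\<^sub>q)
     (0\<^sub>m m\<^sub>q (dim_col J))              (1\<^sub>m m\<^sub>q)"

definition solves_GN ::
  "rmat \<Rightarrow> rvec \<Rightarrow> rmat \<Rightarrow> rvec \<Rightarrow> rvec \<Rightarrow> (rvec \<Rightarrow> rvec) \<Rightarrow> rvec \<Rightarrow> rvec \<Rightarrow> rvec \<Rightarrow> bool" where
  "solves_GN K res J z\<^sub>t z\<^sub>q q r\<^sub>q \<Delta>z\<^sub>t \<Delta>z\<^sub>q \<longleftrightarrow>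
     is_arg_min
       (\<lambda>(d\<^sub>t, d\<^sub>q). (weighted_norm (inverse_mat K)
          ((res @\<^sub>v z\<^sub>t @\<^sub>v z\<^sub>q) + gn_matrix J (dim_vec z\<^sub>q) *\<^sub>v (d\<^sub>t @\<^sub>v d\<^sub>q)))\<^sup>2)
       (\<lambda>(d\<^sub>t, d\<^sub>q). d\<^sub>t \<in> carrier_vec (dim_vec z\<^sub>t) \<and> d\<^sub>q \<in> carrier_vec (dim_vec z\<^sub>q) \<and>
          r\<^sub>q \<le> q (z\<^sub>q + d\<^sub>q))
       (\<Delta>z\<^sub>t, \<Delta>z\<^sub>q)"

definition solves_L ::
  "('a \<Rightarrow> real) set \<Rightarrow> (('a \<Rightarrow> real) \<Rightarrow> ('a \<Rightarrow> real) \<Rightarrow> real) \<Rightarrow>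
   'a functional Matrix.vec \<Rightarrow> rvec \<Rightarrow> 'a functional Matrix.vec \<Rightarrow> (rvec \<Rightarrow> rvec) \<Rightarrow> rvec \<Rightarrow>
   ('a \<Rightarrow> real) \<Rightarrow> bool" where
  "solves_L H ip L_lin b L\<^sub>q q r\<^sub>q s \<longleftrightarrow>
     is_arg_min (hnorm ip)
       (\<lambda>s. s \<in> H \<and> apply_vec L_lin s = b \<and> r\<^sub>q \<le> q (apply_vec L\<^sub>q s)) s"

end

theory Submission
  imports Defs "Jordan_Normal_Form.Determinant"
begin

text \<open>
  The generalized interpolation problem \<open>\<Lambda>(s) = z\<close> has a unique solution of minimal norm, and
  the squared norm of that solution is \<open>\<langle>z, K\<^sup>-\<^sup>1 z\<rangle>\<close> with \<open>K\<close> the Gramian of the Riesz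
  representers. In terms of the shifted variables \<open>z\<^sub>t = z\<^sub>t\<^sup>o\<^sup>l\<^sup>d + \<Delta>z\<^sub>t\<close> and \<open>z\<^sub>q = z\<^sub>q\<^sup>o\<^sup>l\<^sup>d + \<Delta>z\<^sub>q\<close> the
  residual of the Gauss-Newton problem is the vector \<open>(b - J z\<^sub>t, z\<^sub>t, z\<^sub>q)\<close>, and these are exactly
  the values \<open>\<Lambda>(s)\<close> of the functions \<open>s\<close> feasible for the linear recovery problem. Minimizing
  first over all \<open>s\<close> with given values \<open>\<Lambda>(s)\<close> turns one problem into the other.
\<close>

section \<open>Hilbert spaces of functions\<close>

text \<open>A quadratic in \<open>t\<close> that is nowhere negative has nonpositive discriminant:
  evaluate it at its minimizer \<open>- a / b\<close>. It serves both the Cauchy-Schwarz inequality,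
  with \<open>e\<close> a squared norm, and the estimate for almost minimizers, with
  \<open>e\<close> the gap to the infimum.\<close>

lemma discriminant_le:
  fixes a b e :: real
  assumes "\<And>t. 0 \<le> e + 2 * t * a + t\<^sup>2 * b" "0 \<le> b" "b = 0 \<Longrightarrow> a = 0" "0 \<le> e"
  shows "\<bar>a\<bar> \<le> sqrt e * sqrt b"
proof (cases "b = 0")
  case False
  then have b: "b > 0" using assms(2) by simp
  have "0 \<le> e - a\<^sup>2 / b"
    using assms(1)[of "- a / b"] b by (simp add: power2_eq_square field_simps)
  then have "a\<^sup>2 \<le> e * b" using b by (simp add: field_simps)
  then have "sqrt (a\<^sup>2) \<le> sqrt (e * b)" by (rule real_sqrt_le_mono)
  then show ?thesis by (simp add: real_sqrt_mult)
qed (use assms in simp)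

context hilbert_function_space
begin

section \<open>Linear algebra of the inner product\<close>

lemma diff_mem:
  assumes "f \<in> H" "g \<in> H"
  shows "f - g \<in> H"
proof -
  have "f - g = f + (\<lambda>x. (-1) * g x)" by (simp add: fun_eq_iff)
  then show ?thesis using assms add_mem scale_mem by metis
qed

lemma sum_mem:
  fixes w :: "nat \<Rightarrow> 'a \<Rightarrow> real"
  shows "(\<And>i. i < m \<Longrightarrow> w i \<in> H) \<Longrightarrow> (\<lambda>x. \<Sum>i<m. c i * w i x) \<in> H"
proof (induction m)
  case 0
  then show ?case using zero_mem by (simp add: zero_fun_def)
next
  case (Suc m)
  have "(\<lambda>x. \<Sum>i<m. c i * w i x) + (\<lambda>x. c m * w m x) \<in> H"
    using Suc by (intro add_mem scale_mem) auto
  then show ?case by (simp add: plus_fun_def)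
qed

lemma ip_zero_left: "h \<in> H \<Longrightarrow> ip 0 h = 0"
  using ip_scale[of h h 0] by (simp add: zero_fun_def)

lemma ip_diff:
  assumes "f \<in> H" "g \<in> H" "h \<in> H"
  shows "ip (f - g) h = ip f h - ip g h"
proof -
  have "f - g + g = f" by (simp add: fun_eq_iff)
  then show ?thesis using ip_add[OF diff_mem[OF assms(1,2)] assms(2,3)] by simp
qed

lemma ip_sum_left:
  fixes w :: "nat \<Rightarrow> 'a \<Rightarrow> real"
  assumes "h \<in> H"
  shows "(\<And>i. i < m \<Longrightarrow> w i \<in> H) \<Longrightarrow>
    ip (\<lambda>x. \<Sum>i<m. c i * w i x) h = (\<Sum>i<m. c i * ip (w i) h)"
proof (induction m)
  case 0
  then show ?case using ip_zero_left[OF assms] by (simp add: zero_fun_def)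
next
  case (Suc m)
  have "ip ((\<lambda>x. \<Sum>i<m. c i * w i x) + (\<lambda>x. c m * w m x)) h
      = (\<Sum>i<m. c i * ip (w i) h) + c m * ip (w m) h"
    using Suc assms by (subst ip_add) (auto intro: sum_mem scale_mem simp: ip_scale)
  then show ?case by (simp add: plus_fun_def)
qed

lemma ip_sum_right:
  fixes w :: "nat \<Rightarrow> 'a \<Rightarrow> real"
  assumes "h \<in> H" "\<And>i. i < m \<Longrightarrow> w i \<in> H"
  shows "ip h (\<lambda>x. \<Sum>i<m. c i * w i x) = (\<Sum>i<m. c i * ip h (w i))"
proof -
  have "ip h (\<lambda>x. \<Sum>i<m. c i * w i x) = ip (\<lambda>x. \<Sum>i<m. c i * w i x) h"
    using assms by (intro ip_commute sum_mem)
  also have "\<dots> = (\<Sum>i<m. c i * ip h (w i))"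
    using assms ip_commute by (simp add: ip_sum_left)
  finally show ?thesis .
qed

text \<open>Bilinear expansion along the line through \<open>f\<close> in direction
  \<open>h\<close>. It gives the quadratics for \<open>discriminant_le\<close>, and Pythagoras at
  \<open>t = 1\<close> when \<open>f\<close> and \<open>h\<close> are orthogonal.\<close>

lemma ip_line:
  assumes "f \<in> H" "h \<in> H"
  shows "ip (f + (\<lambda>x. t * h x)) (f + (\<lambda>x. t * h x)) = ip f f + 2 * t * ip f h + t\<^sup>2 * ip h h"
proof -
  define g where "g = (\<lambda>x. t * h x)"
  have g: "g \<in> H" using assms scale_mem by (simp add: g_def)
  have gl: "ip g u = t * ip h u" if "u \<in> H" for u
    using that assms ip_scale by (simp add: g_def)
  have fg: "f + g \<in> H" using assms g add_mem by blast
  have "ip (f + g) (f + g) = ip (f + g) f + ip (f + g) g"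
    using ip_add[OF assms(1) g fg] ip_commute[OF assms(1) fg] ip_commute[OF g fg] by simp
  also have "\<dots> = ip f f + ip g f + (ip g f + ip g g)"
    using ip_add[OF assms(1) g] assms g ip_commute[OF assms(1) g] by simp
  also have "\<dots> = ip f f + t * ip f h + (t * ip f h + t * (t * ip h h))"
    using gl assms g ip_commute[OF assms(2) g] ip_commute[OF assms] by simp
  finally show ?thesis by (simp add: g_def power2_eq_square algebra_simps)
qed

section \<open>The norm, the Cauchy-Schwarz inequality and the Riesz representation\<close>

lemma hnorm_nonneg: "f \<in> H \<Longrightarrow> 0 \<le> hnorm ip f"
  by (simp add: hnorm_def ip_nonneg)

lemma hnorm_power2: "f \<in> H \<Longrightarrow> (hnorm ip f)\<^sup>2 = ip f f"
  by (simp add: hnorm_def ip_nonneg)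

lemma cauchy_schwarz:
  assumes "f \<in> H" "g \<in> H"
  shows "\<bar>ip f g\<bar> \<le> hnorm ip f * hnorm ip g"
  unfolding hnorm_def
proof (rule discriminant_le)
  fix t
  have "0 \<le> ip (f + (\<lambda>x. t * g x)) (f + (\<lambda>x. t * g x))"
    using assms by (intro ip_nonneg add_mem scale_mem)
  then show "0 \<le> ip f f + 2 * t * ip f g + t\<^sup>2 * ip g g"
    using ip_line[OF assms] by simp
next
  show "ip f g = 0" if "ip g g = 0"
    using ip_definite[OF assms(2) that] ip_zero_left[OF assms(1)] ip_commute[OF assms] by simp
qed (use assms ip_nonneg in auto)

text \<open>
  The representer is the limit of a minimizing sequence of \<open>\<langle>f, f\<rangle> - 2 l(f)\<close>: almost minimizers
  \<open>f\<close> satisfy \<open>\<langle>f, h\<rangle> = l(h)\<close> up to a small multiple of the norm of \<open>h\<close>, which yields both the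
  Cauchy property and the representation by the limit.
\<close>

lemma ex_riesz:
  assumes l: "l \<in> dual H ip"
  shows "\<exists>w\<in>H. \<forall>h\<in>H. l h = ip h w"
proof -
  have l_add: "l (f + g) = l f + l g" if "f \<in> H" "g \<in> H" for f g
    using l that by (auto simp: dual_def)
  have l_scale: "l (\<lambda>x. c * f x) = c * l f" if "f \<in> H" for c f
    using l that by (auto simp: dual_def)
  have "\<exists>C. \<forall>f\<in>H. \<bar>l f\<bar> \<le> C * hnorm ip f" using l by (simp add: dual_def)
  then obtain C where C: "\<And>f. f \<in> H \<Longrightarrow> \<bar>l f\<bar> \<le> C * hnorm ip f" by blast
  define E where "E f = ip f f - 2 * l f" for f
  \<comment> \<open>Completing the square with the bound \<open>C\<close> of the functional shows
    that the infimum of \<open>E\<close> is finite.\<close>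
  have E_ge: "- C\<^sup>2 \<le> E f" if "f \<in> H" for f
  proof -
    have "0 \<le> (hnorm ip f - C)\<^sup>2" by simp
    then have "- C\<^sup>2 \<le> (hnorm ip f)\<^sup>2 - 2 * (C * hnorm ip f)"
      by (simp add: power2_eq_square algebra_simps)
    then show ?thesis using C[OF that] hnorm_power2[OF that] by (auto simp: E_def)
  qed
  define \<mu> where "\<mu> = Inf (E ` H)"
  have bdd: "bdd_below (E ` H)" using E_ge by (intro bdd_belowI) auto
  have \<mu>_le: "\<mu> \<le> E f" if "f \<in> H" for f
    unfolding \<mu>_def using bdd that by (intro cInf_lower) auto
  have "\<exists>f\<in>H. E f < \<mu> + inverse (Suc n)" for n
  proof -
    have "Inf (E ` H) < \<mu> + inverse (Suc n)" by (simp add: \<mu>_def)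
    then show ?thesis using cInf_lessD[of "E ` H"] zero_mem by blast
  qed
  then obtain F where F: "F n \<in> H" "E (F n) < \<mu> + inverse (Suc n)" for n by metis
  define r where "r n = sqrt (inverse (Suc n))" for n
  \<comment> \<open>A move from \<open>F n\<close> along \<open>h\<close> lowers \<open>E\<close> by
    less than \<open>inverse (Suc n)\<close>, since \<open>E\<close> stays above its infimum. The
    resulting quadratic in \<open>t\<close> is nonnegative and its discriminant gives the
    bound.\<close>
  have near: "\<bar>ip (F n) h - l h\<bar> \<le> r n * hnorm ip h" if h: "h \<in> H" for n h
    unfolding r_def hnorm_def
  proof (rule discriminant_le)
    fix t
    have "\<mu> \<le> E (F n + (\<lambda>x. t * h x))" using F h by (intro \<mu>_le add_mem scale_mem)
    also have "\<dots> = E (F n) + 2 * t * (ip (F n) h - l h) + t\<^sup>2 * ip h h"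
      using l_add[OF F(1) scale_mem[OF h]] l_scale[OF h] ip_line[OF F(1) h]
      by (simp add: E_def algebra_simps)
    finally show "0 \<le> inverse (Suc n) + 2 * t * (ip (F n) h - l h) + t\<^sup>2 * ip h h"
      using F(2)[of n] by linarith
  next
    assume "ip h h = 0"
    then have "hnorm ip h = 0" by (simp add: hnorm_def)
    then show "ip (F n) h - l h = 0" using C[OF h] cauchy_schwarz[OF F(1) h, of n] by simp
  qed (use h ip_nonneg in auto)
  have r_lim: "r \<longlonglongrightarrow> 0"
    using tendsto_real_sqrt[OF LIMSEQ_inverse_real_of_nat] by (simp add: r_def[abs_def])
  have "\<exists>f\<in>H. (\<lambda>n. hnorm ip (F n - f)) \<longlonglongrightarrow> 0"
  proof (rule complete[OF F(1)])
    fix e :: real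
    assume "e > 0"
    then have "eventually (\<lambda>n. r n < e / 2) sequentially"
      using r_lim by (intro order_tendstoD(2)) auto
    then obtain N where N: "r n < e / 2" if "n \<ge> N" for n
      by (auto simp: eventually_sequentially)
    have "hnorm ip (F m - F n) < e" if "m \<ge> N" "n \<ge> N" for m n
    proof -
      \<comment> \<open>Testing both estimates with the difference itself cancels
        \<open>l h\<close>; one factor \<open>hnorm ip h\<close> is then divided out, the case of
        norm zero being separate.\<close>
      define h where "h = F m - F n"
      have h: "h \<in> H" using F(1) diff_mem by (simp add: h_def)
      have "(hnorm ip h)\<^sup>2 = (ip (F m) h - l h) - (ip (F n) h - l h)"
        using ip_diff[OF F(1) F(1) h] hnorm_power2[OF h] by (simp add: h_def)
      also have "\<dots> \<le> (r m + r n) * hnorm ip h"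
        using near[OF h, of m] near[OF h, of n] by (simp add: algebra_simps abs_le_iff)
      finally have "hnorm ip h * hnorm ip h \<le> (r m + r n) * hnorm ip h"
        by (simp add: power2_eq_square)
      then have "hnorm ip h \<le> r m + r n \<or> hnorm ip h = 0"
        using hnorm_nonneg[OF h] by auto
      then show ?thesis using N[OF that(1)] N[OF that(2)] \<open>e > 0\<close> by (auto simp: h_def)
    qed
    then show "\<exists>N. \<forall>m\<ge>N. \<forall>n\<ge>N. hnorm ip (F m - F n) < e" by blast
  qed
  then obtain w where w: "w \<in> H" "(\<lambda>n. hnorm ip (F n - w)) \<longlonglongrightarrow> 0" by blast
  have "l h = ip h w" if h: "h \<in> H" for h
  proof -
    \<comment> \<open>The error at the limit is at most the distance from \<open>F n\<close> to
      \<open>w\<close>, weighted by Cauchy-Schwarz, plus the almost-minimizer error; both tend to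
      zero.\<close>
    have "(\<lambda>n. (hnorm ip (F n - w) + r n) * hnorm ip h) \<longlonglongrightarrow> (0 + 0) * hnorm ip h"
      by (intro tendsto_intros w(2) r_lim)
    moreover have "\<bar>ip w h - l h\<bar> \<le> (hnorm ip (F n - w) + r n) * hnorm ip h" for n
    proof -
      have "\<bar>ip w h - l h\<bar> \<le> \<bar>ip (F n - w) h\<bar> + \<bar>ip (F n) h - l h\<bar>"
        using ip_diff[OF F(1) w(1) h, of n] by linarith
      also have "\<dots> \<le> hnorm ip (F n - w) * hnorm ip h + r n * hnorm ip h"
        using cauchy_schwarz[OF diff_mem[OF F(1) w(1)] h] near[OF h] by (intro add_mono)
      finally show ?thesis by (simp add: algebra_simps)
    qed
    ultimately have "\<bar>ip w h - l h\<bar> \<le> 0"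
      by (intro LIMSEQ_le_const[where X = "\<lambda>n. (hnorm ip (F n - w) + r n) * hnorm ip h"]) auto
    then show ?thesis using ip_commute[OF h w(1)] by simp
  qed
  then show ?thesis using w(1) by blast
qed

text \<open>Testing with \<open>f = v - w\<close> gives a difference of squared norm zero. This is
  the uniqueness behind the definite description in \<open>riesz\<close>.\<close>

lemma eq_if_ip_eq:
  assumes "v \<in> H" "w \<in> H" "\<And>f. f \<in> H \<Longrightarrow> ip f v = ip f w"
  shows "v = w"
proof -
  have d: "v - w \<in> H" using assms diff_mem by blast
  have "ip (v - w) (v - w) = ip (v - w) v - ip (v - w) w"
    using ip_diff[OF assms(1,2) d] ip_commute[OF d] assms by simp
  then have "v - w = 0" using assms d ip_definite[OF d] by simp
  then show ?thesis by simp
qed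

lemma riesz_mem: "l \<in> dual H ip \<Longrightarrow> riesz H ip l \<in> H"
  and riesz_apply: "l \<in> dual H ip \<Longrightarrow> f \<in> H \<Longrightarrow> l f = ip f (riesz H ip l)"
proof -
  have "riesz H ip l \<in> H \<and> (\<forall>f\<in>H. l f = ip f (riesz H ip l))" if l: "l \<in> dual H ip"
  proof -
    have "\<exists>!w. w \<in> H \<and> (\<forall>f\<in>H. l f = ip f w)"
      using ex_riesz[OF l] by (metis eq_if_ip_eq)
    from theI'[OF this] show ?thesis unfolding riesz_def .
  qed
  then show "l \<in> dual H ip \<Longrightarrow> riesz H ip l \<in> H"
    and "l \<in> dual H ip \<Longrightarrow> f \<in> H \<Longrightarrow> l f = ip f (riesz H ip l)" by blast+
qed


section \<open>Minimal-norm interpolation\<close>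

text \<open>A null vector \<open>v\<close> of the Gramian gives a combination \<open>f\<close> of
  representers that is orthogonal to every representer, hence to itself, so \<open>f = 0\<close>.
  Then \<open>v\<close> is a linear relation between the functionals, which independence
  excludes.\<close>

lemma inverse_gramian:
  assumes L: "L \<in> dual_vec H ip m" and indep: "lin_indep_on H L"
  shows "inverse_mat (gramian H ip L) \<in> carrier_mat m m"
    and "gramian H ip L * inverse_mat (gramian H ip L) = 1\<^sub>m m"
proof -
  define w where "w i = riesz H ip (L $ i)" for i
  define K where "K = gramian H ip L"
  have dim: "dim_vec L = m" using L by (auto simp: dual_vec_def)
  have dual: "L $ i \<in> dual H ip" if "i < m" for i using L that by (auto simp: dual_vec_def)
  have w: "w i \<in> H" if "i < m" for i using riesz_mem[OF dual[OF that]] by (simp add: w_def)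
  have K: "K \<in> carrier_mat m m" by (simp add: K_def gramian_def dim)
  have "det K \<noteq> 0"
  proof
    assume "det K = 0"
    then obtain v where v: "v \<in> carrier_vec m" "v \<noteq> 0\<^sub>v m" "K *\<^sub>v v = 0\<^sub>v m"
      using det_0_iff_vec_prod_zero_field[OF K] by blast
    define f where "f = (\<lambda>x. \<Sum>i<m. v $ i * w i x)"
    have f: "f \<in> H" using w sum_mem by (simp add: f_def)
    have ker: "ip (w i) f = 0" if "i < m" for i
    proof -
      have "ip (w i) f = (K *\<^sub>v v) $ i"
        using that w v(1) by (simp add: f_def ip_sum_right K_def gramian_def dim scalar_prod_def
            w_def atLeast0LessThan mult.commute)
      then show ?thesis using v(3) that by simp
    qed
    have "ip f f = (\<Sum>i<m. v $ i * ip (w i) f)"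
      unfolding f_def by (rule ip_sum_left) (use w f in \<open>auto simp: f_def\<close>)
    then have "f = 0" using ker ip_definite[OF f] by simp
    then have "(\<Sum>i<m. v $ i * (L $ i) s) = 0" if "s \<in> H" for s
      using that dual w ip_sum_right[OF that, of m w "\<lambda>i. v $ i"] ip_zero_left[OF that]
        ip_commute[OF that f] by (simp add: f_def riesz_apply w_def)
    then have "v $ i = 0" if "i < m" for i
      using indep that unfolding lin_indep_on_def dim by blast
    then show False using v(1,2) by auto
  qed
  then have "K \<in> Units (ring_mat TYPE(real) m ())" by (rule det_non_zero_imp_unit[OF K])
  then obtain B where "mat_inverse K = Some B" using mat_inverse(1)[OF K, of "()"] by blast
  then show "inverse_mat (gramian H ip L) \<in> carrier_mat m m"
    and "gramian H ip L * inverse_mat (gramian H ip L) = 1\<^sub>m m"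
    using mat_inverse(2)[OF K] by (auto simp: inverse_mat_def K_def)
qed

text \<open>The minimizer is the combination of representers whose coefficients \<open>c\<close>
  solve \<open>K c = z\<close>, so its squared norm is the scalar product of \<open>z\<close> and
  \<open>c\<close>. Any other interpolant differs from it by an orthogonal element and is strictly
  longer by Pythagoras.\<close>

lemma min_norm_interpolant:
  assumes L: "L \<in> dual_vec H ip m" and indep: "lin_indep_on H L" and z: "z \<in> carrier_vec m"
  obtains s where "s \<in> H" "apply_vec L s = z"
    "hnorm ip s = weighted_norm (inverse_mat (gramian H ip L)) z"
    "\<And>s'. s' \<in> H \<Longrightarrow> apply_vec L s' = z \<Longrightarrow> s' \<noteq> s \<Longrightarrow> hnorm ip s < hnorm ip s'"
proof -
  define w where "w i = riesz H ip (L $ i)" for i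
  define K where "K = gramian H ip L"
  define c where "c = inverse_mat K *\<^sub>v z"
  define s where "s = (\<lambda>x. \<Sum>i<m. c $ i * w i x)"
  have dim: "dim_vec L = m" using L by (auto simp: dual_vec_def)
  have dual: "L $ i \<in> dual H ip" if "i < m" for i using L that by (auto simp: dual_vec_def)
  have w: "w i \<in> H" if "i < m" for i using riesz_mem[OF dual[OF that]] by (simp add: w_def)
  have K: "K \<in> carrier_mat m m" by (simp add: K_def gramian_def dim)
  note inv = inverse_gramian[OF L indep, folded K_def]
  have c: "c \<in> carrier_vec m" using inv(1) z by (simp add: c_def)
  have Kc: "K *\<^sub>v c = z"
    using assoc_mult_mat_vec[OF K inv(1) z] inv(2) z by (simp add: c_def)
  have s: "s \<in> H" using w sum_mem by (simp add: s_def)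
  have Ls: "(L $ i) s = z $ i" if i: "i < m" for i
  proof -
    have "(L $ i) s = ip (w i) s"
      using riesz_apply[OF dual[OF i] s] ip_commute[OF s w[OF i]] by (simp add: w_def)
    also have "\<dots> = (K *\<^sub>v c) $ i"
      using i w c by (simp add: s_def ip_sum_right K_def gramian_def dim scalar_prod_def
          w_def atLeast0LessThan mult.commute)
    finally show ?thesis by (simp add: Kc)
  qed
  \<comment> \<open>The inner product with \<open>s\<close> depends only on the values of the
    functionals. Hence \<open>s\<close> is orthogonal to the difference of two interpolants of the
    same data.\<close>
  have ip_s: "ip s f = (\<Sum>i<m. c $ i * (L $ i) f)" if f: "f \<in> H" for f
    using w f dual ip_commute[OF f]
    by (simp add: s_def ip_sum_left riesz_apply w_def)
  have "ip s s = z \<bullet> c"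
    using ip_s[OF s] Ls z c by (simp add: scalar_prod_def lessThan_atLeast0 mult.commute)
  then have norm: "hnorm ip s = weighted_norm (inverse_mat K) z"
    by (simp add: hnorm_def weighted_norm_def c_def)
  have strict: "hnorm ip s < hnorm ip s'" if s': "s' \<in> H" "apply_vec L s' = z" "s' \<noteq> s" for s'
  proof -
    define d where "d = s' - s"
    have d: "d \<in> H" using s s'(1) diff_mem by (simp add: d_def)
    have Ls': "(L $ i) s' = z $ i" if "i < m" for i
      using s'(2) that dim by (auto simp: apply_vec_def)
    have "ip s s' = ip s s" using ip_s[OF s] ip_s[OF s'(1)] Ls Ls' by simp
    then have sd: "ip s d = 0"
      using ip_diff[OF s'(1) s s] ip_commute[OF s d] ip_commute[OF s s'(1)] by (simp add: d_def)
    have "d \<noteq> 0" using s'(3) by (simp add: d_def)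
    then have "0 < ip d d" using ip_nonneg[OF d] ip_definite[OF d] by force
    moreover have "s' = s + (\<lambda>x. 1 * d x)" by (simp add: d_def fun_eq_iff)
    then have "ip s' s' = ip s s + ip d d" using ip_line[OF s d, of 1] sd by simp
    ultimately show ?thesis by (simp add: hnorm_def)
  qed
  show thesis
    by (rule that[OF s _ norm[unfolded K_def] strict])
      (use Ls dim z in \<open>auto simp: apply_vec_def\<close>)
qed

text \<open>The element \<open>s\<close> competes with the minimal-norm interpolant of its own
  data.\<close>

lemma weighted_norm_le_hnorm:
  assumes "L \<in> dual_vec H ip m" "lin_indep_on H L" "s \<in> H"
  shows "weighted_norm (inverse_mat (gramian H ip L)) (apply_vec L s) \<le> hnorm ip s"
proof -
  have "apply_vec L s \<in> carrier_vec m"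
    using assms(1) by (auto simp: apply_vec_def dual_vec_def)
  then obtain s0 where "hnorm ip s0 = weighted_norm (inverse_mat (gramian H ip L)) (apply_vec L s)"
    "s \<noteq> s0 \<Longrightarrow> hnorm ip s0 < hnorm ip s"
    using min_norm_interpolant[OF assms(1,2)] assms(3) by metis
  then show ?thesis by (cases "s = s0") auto
qed

text \<open>The value is the norm of an interpolant. The sign matters because \<open>sqrt\<close> is
  odd on the reals, and it allows the squares in the Gauss-Newton objective to be dropped.\<close>

lemma weighted_norm_nonneg:
  assumes "L \<in> dual_vec H ip m" "lin_indep_on H L" "z \<in> carrier_vec m"
  shows "0 \<le> weighted_norm (inverse_mat (gramian H ip L)) z"
  using min_norm_interpolant[OF assms] hnorm_nonneg by metis

end


section \<open>Vectors of functionals and the Gauss-Newton matrix\<close>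

lemma append_vec_assoc: "(u @\<^sub>v v) @\<^sub>v w = u @\<^sub>v v @\<^sub>v w"
  by (rule eq_vecI) auto

lemma apply_vec_append: "apply_vec (L @\<^sub>v M) s = apply_vec L s @\<^sub>v apply_vec M s"
  by (rule eq_vecI) (auto simp: apply_vec_def)

lemma apply_vec_carrier:
  "L \<in> dual_vec H ip m \<Longrightarrow> apply_vec L s \<in> carrier_vec m"
  by (auto simp: apply_vec_def dual_vec_def)

lemma dual_vec_append:
  "L \<in> dual_vec H ip m \<Longrightarrow> M \<in> dual_vec H ip n \<Longrightarrow> L @\<^sub>v M \<in> dual_vec H ip (m + n)"
  by (auto simp: dual_vec_def)

lemma apply_vec_add_mat_functionals:
  assumes "L \<in> carrier_vec n" "M \<in> carrier_vec m" "J \<in> carrier_mat n m"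
  shows "apply_vec (L + mat_functionals J M) s = apply_vec L s + J *\<^sub>v apply_vec M s"
  using assms
  by (intro eq_vecI) (auto simp: apply_vec_def mat_functionals_def scalar_prod_def lessThan_atLeast0)

lemma sum_lessThan_add:
  fixes f :: "nat \<Rightarrow> 'b::comm_monoid_add"
  shows "(\<Sum>i<m + n. f i) = (\<Sum>i<m. f i) + (\<Sum>i<n. f (m + i))"
  by (induction n) (auto simp: add.assoc)

text \<open>A relation with coefficient blocks \<open>(a, e)\<close> among the new functionals is
  the relation \<open>(a, J^T a, e)\<close> among the original ones, and it keeps both blocks
  \<open>a\<close> and \<open>e\<close>.\<close>

lemma lin_indep_on_add_mat_functionals:
  fixes L\<^sub>0 L\<^sub>t L\<^sub>q :: "'a functional Matrix.vec"
  assumes indep: "lin_indep_on H (L\<^sub>0 @\<^sub>v L\<^sub>t @\<^sub>v L\<^sub>q)"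
    and L0: "L\<^sub>0 \<in> carrier_vec n" and Lt: "L\<^sub>t \<in> carrier_vec m" and Lq: "L\<^sub>q \<in> carrier_vec k"
    and J: "J \<in> carrier_mat n m"
  shows "lin_indep_on H ((L\<^sub>0 + mat_functionals J L\<^sub>t) @\<^sub>v L\<^sub>q)"
  unfolding lin_indep_on_def
proof (intro allI impI)
  let ?M = "(L\<^sub>0 + mat_functionals J L\<^sub>t) @\<^sub>v L\<^sub>q"
  let ?L = "L\<^sub>0 @\<^sub>v L\<^sub>t @\<^sub>v L\<^sub>q"
  have dims: "dim_vec L\<^sub>0 = n" "dim_vec L\<^sub>t = m" "dim_vec L\<^sub>q = k" "dim_row J = n"
    using assms by auto
  have dimM: "dim_vec ?M = n + k" using dims by (simp add: mat_functionals_def)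
  have dimL: "dim_vec ?L = n + (m + k)" using dims by simp
  fix c :: "nat \<Rightarrow> real" and i
  assume c: "\<forall>s\<in>H. (\<Sum>i<dim_vec ?M. c i * (?M $ i) s) = 0" and i: "i < dim_vec ?M"
  \<comment> \<open>The middle block is the transpose of \<open>J\<close> applied to the first block
    of \<open>c\<close>. The index \<open>j - m\<close> skips this block, so that the last block of
    \<open>d\<close> is the last block of \<open>c\<close>.\<close>
  define d where "d j = (if j < n then c j else if j < n + m
      then (\<Sum>i<n. c i * J $$ (i, j - n)) else c (j - m))" for j
  have "(\<Sum>j<dim_vec ?L. d j * (?L $ j) s) = 0" if s: "s \<in> H" for s
  proof -
    have "(\<Sum>j<dim_vec ?L. d j * (?L $ j) s) = (\<Sum>j<n. c j * (L\<^sub>0 $ j) s)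
        + ((\<Sum>j<m. (\<Sum>i<n. c i * J $$ (i, j)) * (L\<^sub>t $ j) s) + (\<Sum>j<k. c (n + j) * (L\<^sub>q $ j) s))"
      unfolding dimL sum_lessThan_add by (simp add: dims d_def)
    also have "(\<Sum>j<m. (\<Sum>i<n. c i * J $$ (i, j)) * (L\<^sub>t $ j) s)
        = (\<Sum>i<n. c i * (\<Sum>j<m. J $$ (i, j) * (L\<^sub>t $ j) s))"
      unfolding sum_distrib_left sum_distrib_right
      by (subst sum.swap) (simp add: mult.assoc)
    also have "(\<Sum>j<n. c j * (L\<^sub>0 $ j) s) + (\<dots> + (\<Sum>j<k. c (n + j) * (L\<^sub>q $ j) s))
        = (\<Sum>i<dim_vec ?M. c i * (?M $ i) s)"
      unfolding dimM sum_lessThan_add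
      by (simp add: dims mat_functionals_def algebra_simps sum.distrib)
    finally show ?thesis using c s by simp
  qed
  then have d: "d j = 0" if "j < n + (m + k)" for j
    using indep that unfolding lin_indep_on_def dimL by blast
  show "c i = 0"
  proof (cases "i < n")
    case True
    then show ?thesis using d[of i] by (simp add: d_def)
  next
    case False
    then show ?thesis using d[of "i + m"] i dimM by (simp add: d_def)
  qed
qed

text \<open>Block multiplication brings the residual into a form in which the two lower blocks are
  the shifted variables themselves.\<close>

lemma gn_residual:
  fixes res z\<^sub>t z\<^sub>q d\<^sub>t d\<^sub>q :: rvec
  assumes J: "J \<in> carrier_mat n m" and res: "res \<in> carrier_vec n"
    and z: "z\<^sub>t \<in> carrier_vec m" "z\<^sub>q \<in> carrier_vec k"
    and d: "d\<^sub>t \<in> carrier_vec m" "d\<^sub>q \<in> carrier_vec k"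
  shows "(res @\<^sub>v z\<^sub>t @\<^sub>v z\<^sub>q) + gn_matrix J (dim_vec z\<^sub>q) *\<^sub>v (d\<^sub>t @\<^sub>v d\<^sub>q)
    = (res - J *\<^sub>v d\<^sub>t) @\<^sub>v (z\<^sub>t + d\<^sub>t) @\<^sub>v (z\<^sub>q + d\<^sub>q)"
proof -
  have dims: "dim_vec z\<^sub>q = k" "dim_row J = n" "dim_col J = m" using J z by auto
  have A: "(- J) @\<^sub>r 1\<^sub>m m \<in> carrier_mat (n + m) m" using J by simp
  have "gn_matrix J (dim_vec z\<^sub>q) *\<^sub>v (d\<^sub>t @\<^sub>v d\<^sub>q)
      = (((- J) @\<^sub>r 1\<^sub>m m) *\<^sub>v d\<^sub>t + 0\<^sub>m (n + m) k *\<^sub>v d\<^sub>q) @\<^sub>v (0\<^sub>m k m *\<^sub>v d\<^sub>t + 1\<^sub>m k *\<^sub>v d\<^sub>q)"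
    unfolding gn_matrix_def dims using A d by (intro four_block_mat_mult_vec) auto
  also have "((- J) @\<^sub>r 1\<^sub>m m) *\<^sub>v d\<^sub>t = (- (J *\<^sub>v d\<^sub>t)) @\<^sub>v d\<^sub>t"
    using mat_mult_append[of "- J" n m "1\<^sub>m m" m d\<^sub>t] J d by simp
  finally have "gn_matrix J (dim_vec z\<^sub>q) *\<^sub>v (d\<^sub>t @\<^sub>v d\<^sub>q) = (- (J *\<^sub>v d\<^sub>t)) @\<^sub>v d\<^sub>t @\<^sub>v d\<^sub>q"
    using J d by (intro eq_vecI) auto
  then show ?thesis using J res z d by (intro eq_vecI) auto
qed

section \<open>The Gauss-Newton subproblem and the linear recovery problem\<close>

theorem theorem3p7:
  fixes \<Omega> :: "'a set" and k :: "'a \<Rightarrow> 'a \<Rightarrow> real"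
    and H :: "('a \<Rightarrow> real) set" and ip :: "('a \<Rightarrow> real) \<Rightarrow> ('a \<Rightarrow> real) \<Rightarrow> real"
    and m\<^sub>p m\<^sub>q n\<^sub>p n\<^sub>q :: nat
    and L\<^sub>p L\<^sub>q L\<^sub>0 L\<^sub>t L_lin :: "'a functional Matrix.vec"
    and p q pt :: "rvec \<Rightarrow> rvec" and r\<^sub>p r\<^sub>q zt_old zq_old b_old :: rvec
    and J K :: rmat and s_old :: "'a \<Rightarrow> real"
  assumes "\<Omega> \<noteq> {}" and "pos_def_kernel \<Omega> k" and "rkhs \<Omega> k H ip"
    and "n\<^sub>p \<le> m\<^sub>p" and "n\<^sub>q \<le> m\<^sub>q"
    and "L\<^sub>p \<in> dual_vec H ip m\<^sub>p" and "L\<^sub>q \<in> dual_vec H ip m\<^sub>q"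
    and "r\<^sub>p \<in> carrier_vec n\<^sub>p" and "r\<^sub>q \<in> carrier_vec n\<^sub>q"
    and "continuous_vec_fun m\<^sub>p n\<^sub>p p" and "continuous_vec_fun m\<^sub>q n\<^sub>q q"
    and "lin_indep_on H (L\<^sub>p @\<^sub>v L\<^sub>q)"
    and "\<exists>s\<in>H. p (apply_vec L\<^sub>p s) = r\<^sub>p \<and> r\<^sub>q \<le> q (apply_vec L\<^sub>q s)"
    and "C1_vec_fun (m\<^sub>p - n\<^sub>p) n\<^sub>p pt"
    and "\<And>z0 zt. z0 \<in> carrier_vec n\<^sub>p \<Longrightarrow> zt \<in> carrier_vec (m\<^sub>p - n\<^sub>p) \<Longrightarrow> p (z0 @\<^sub>v zt) = z0 + pt zt"
    and "L\<^sub>p = L\<^sub>0 @\<^sub>v L\<^sub>t" and "L\<^sub>0 \<in> dual_vec H ip n\<^sub>p" and "L\<^sub>t \<in> dual_vec H ip (m\<^sub>p - n\<^sub>p)"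
    and "s_old \<in> H"
    and "zt_old = apply_vec L\<^sub>t s_old" and "zq_old = apply_vec L\<^sub>q s_old"
    and "J = jacobian n\<^sub>p pt zt_old"
    and "L_lin = L\<^sub>0 + mat_functionals J L\<^sub>t"
    and "b_old = r\<^sub>p - pt zt_old + J *\<^sub>v zt_old"
    and "K = gramian H ip (L\<^sub>p @\<^sub>v L\<^sub>q)"
  shows
    "(\<forall>\<Delta>zt \<Delta>zq z0 zt zq.
        solves_GN K (r\<^sub>p - pt zt_old) J zt_old zq_old q r\<^sub>q \<Delta>zt \<Delta>zq \<longrightarrow>
        zt = zt_old + \<Delta>zt \<longrightarrow> zq = zq_old + \<Delta>zq \<longrightarrow> z0 = b_old - J *\<^sub>v zt \<longrightarrow>
        (\<exists>!s. is_arg_min (hnorm ip)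
               (\<lambda>s. s \<in> H \<and> apply_vec L\<^sub>0 s = z0 \<and> apply_vec L\<^sub>t s = zt \<and> apply_vec L\<^sub>q s = zq) s) \<and>
        (\<forall>s. is_arg_min (hnorm ip)
               (\<lambda>s. s \<in> H \<and> apply_vec L\<^sub>0 s = z0 \<and> apply_vec L\<^sub>t s = zt \<and> apply_vec L\<^sub>q s = zq) s \<longrightarrow>
             solves_L H ip L_lin b_old L\<^sub>q q r\<^sub>q s)) \<and>
     (\<forall>s. solves_L H ip L_lin b_old L\<^sub>q q r\<^sub>q s \<longrightarrow>
        solves_GN K (r\<^sub>p - pt zt_old) J zt_old zq_old q r\<^sub>q
          (apply_vec L\<^sub>t s - zt_old) (apply_vec L\<^sub>q s - zq_old)) \<and>
     lin_indep_on H (L_lin @\<^sub>v L\<^sub>q)"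
proof -
  interpret rkhs \<Omega> k H ip by fact
  define m\<^sub>t where "m\<^sub>t = m\<^sub>p - n\<^sub>p"
  define \<Lambda> where "\<Lambda> = L\<^sub>0 @\<^sub>v L\<^sub>t @\<^sub>v L\<^sub>q"
  define W where "W = weighted_norm (inverse_mat K)"
  have L0: "L\<^sub>0 \<in> dual_vec H ip n\<^sub>p" and Lt: "L\<^sub>t \<in> dual_vec H ip m\<^sub>t" and Lq: "L\<^sub>q \<in> dual_vec H ip m\<^sub>q"
    using assms by (auto simp: m\<^sub>t_def)
  have carriers: "L\<^sub>0 \<in> carrier_vec n\<^sub>p" "L\<^sub>t \<in> carrier_vec m\<^sub>t" "L\<^sub>q \<in> carrier_vec m\<^sub>q"
    using L0 Lt Lq by (auto simp: dual_vec_def)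
  have app: "L\<^sub>p @\<^sub>v L\<^sub>q = \<Lambda>"
    using \<open>L\<^sub>p = L\<^sub>0 @\<^sub>v L\<^sub>t\<close> by (simp add: \<Lambda>_def append_vec_assoc)
  have \<Lambda>: "\<Lambda> \<in> dual_vec H ip (n\<^sub>p + (m\<^sub>t + m\<^sub>q))"
    unfolding \<Lambda>_def by (intro dual_vec_append L0 Lt Lq)
  have indep: "lin_indep_on H \<Lambda>" using \<open>lin_indep_on H (L\<^sub>p @\<^sub>v L\<^sub>q)\<close> by (simp add: app)
  have K: "K = gramian H ip \<Lambda>" using \<open>K = gramian H ip (L\<^sub>p @\<^sub>v L\<^sub>q)\<close> by (simp only: app)
  have zt_old: "zt_old \<in> carrier_vec m\<^sub>t" and zq_old: "zq_old \<in> carrier_vec m\<^sub>q"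
    using assms Lt Lq by (auto intro: apply_vec_carrier)
  have pt: "pt zt_old \<in> carrier_vec n\<^sub>p"
    using \<open>C1_vec_fun (m\<^sub>p - n\<^sub>p) n\<^sub>p pt\<close> zt_old by (auto simp: C1_vec_fun_def m\<^sub>t_def)
  have J: "J \<in> carrier_mat n\<^sub>p m\<^sub>t"
    using \<open>J = jacobian n\<^sub>p pt zt_old\<close> zt_old by (auto simp: jacobian_def)
  have r: "r\<^sub>p - pt zt_old \<in> carrier_vec n\<^sub>p" using pt \<open>r\<^sub>p \<in> carrier_vec n\<^sub>p\<close> by auto
  have b: "b_old \<in> carrier_vec n\<^sub>p" using \<open>b_old = _\<close> J zt_old r by simp

  \<comment> \<open>Admissible data vectors and their interpolants\<close>
  have bJ: "b_old - J *\<^sub>v v \<in> carrier_vec n\<^sub>p" for v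
    using b J by (intro carrier_vecI) auto
  \<comment> \<open>The linear constraint determines the first block from \<open>zt\<close>, so
    \<open>Z\<close> parametrizes all values of \<open>\<Lambda>\<close> that it allows by the two
    free blocks.\<close>
  define Z where "Z zt zq = (b_old - J *\<^sub>v zt) @\<^sub>v zt @\<^sub>v zq" for zt zq
  have Z: "Z zt zq \<in> carrier_vec (n\<^sub>p + (m\<^sub>t + m\<^sub>q))"
    if "zt \<in> carrier_vec m\<^sub>t" "zq \<in> carrier_vec m\<^sub>q" for zt zq
    using that b J by (auto simp: Z_def)
  have feasible_iff: "apply_vec L_lin s = b_old \<longleftrightarrow> apply_vec \<Lambda> s = Z (apply_vec L\<^sub>t s) (apply_vec L\<^sub>q s)"
    for s
  proof -
    have ap: "apply_vec L\<^sub>0 s \<in> carrier_vec n\<^sub>p" "apply_vec L\<^sub>t s \<in> carrier_vec m\<^sub>t"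
      using L0 Lt by (auto intro: apply_vec_carrier)
    have "apply_vec L_lin s = apply_vec L\<^sub>0 s + J *\<^sub>v apply_vec L\<^sub>t s"
      using apply_vec_add_mat_functionals[OF carriers(1,2) J] assms by simp
    also have "\<dots> = b_old \<longleftrightarrow> apply_vec L\<^sub>0 s = b_old - J *\<^sub>v apply_vec L\<^sub>t s"
      using ap b J by (auto simp: vec_eq_iff)
    also have "\<dots> \<longleftrightarrow> apply_vec \<Lambda> s = Z (apply_vec L\<^sub>t s) (apply_vec L\<^sub>q s)"
      unfolding \<Lambda>_def apply_vec_append Z_def
      using append_vec_eq[OF ap(1) bJ] by simp
    finally show ?thesis .
  qed
  have interp_iff: "apply_vec \<Lambda> s = Z zt zq \<longleftrightarrow>
      apply_vec L\<^sub>0 s = b_old - J *\<^sub>v zt \<and> apply_vec L\<^sub>t s = zt \<and> apply_vec L\<^sub>q s = zq"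
    if "zt \<in> carrier_vec m\<^sub>t" "zq \<in> carrier_vec m\<^sub>q" for s zt zq
    unfolding \<Lambda>_def apply_vec_append Z_def append_vec_eq[OF apply_vec_carrier[OF L0] bJ]
      append_vec_eq[OF apply_vec_carrier[OF Lt] that(1)] ..
  have interp: "\<exists>s\<in>H. apply_vec \<Lambda> s = Z zt zq \<and> hnorm ip s = W (Z zt zq) \<and>
      (\<forall>s'\<in>H. apply_vec \<Lambda> s' = Z zt zq \<longrightarrow> s' \<noteq> s \<longrightarrow> hnorm ip s < hnorm ip s')"
    if "zt \<in> carrier_vec m\<^sub>t" "zq \<in> carrier_vec m\<^sub>q" for zt zq
    using min_norm_interpolant[OF \<Lambda> indep Z[OF that]] unfolding W_def K by metis
  have W_le: "W (apply_vec \<Lambda> s) \<le> hnorm ip s" if "s \<in> H" for s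
    using weighted_norm_le_hnorm[OF \<Lambda> indep that] by (simp add: W_def K)

  \<comment> \<open>The Gauss-Newton problem in shifted variables\<close>
  have residual: "((r\<^sub>p - pt zt_old) @\<^sub>v zt_old @\<^sub>v zq_old) + gn_matrix J (dim_vec zq_old) *\<^sub>v (dt @\<^sub>v dq)
      = Z (zt_old + dt) (zq_old + dq)"
    if d: "dt \<in> carrier_vec m\<^sub>t" "dq \<in> carrier_vec m\<^sub>q" for dt dq
  proof -
    \<comment> \<open>The term \<open>J zt_old\<close> contained in \<open>b_old\<close> cancels
      against the one from \<open>J (zt_old + dt)\<close>.\<close>
    have "r\<^sub>p - pt zt_old - J *\<^sub>v dt = b_old - J *\<^sub>v (zt_old + dt)"
      using \<open>b_old = _\<close> J zt_old d r mult_add_distrib_mat_vec[OF J zt_old d(1)]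
      by (auto simp: vec_eq_iff)
    then show ?thesis using gn_residual[OF J r zt_old zq_old d] by (simp add: Z_def)
  qed
  \<comment> \<open>Translating by the old values and dropping the square turns the problem into
    minimizing \<open>W (Z zt zq)\<close> over all \<open>zt\<close> and all \<open>zq\<close> with
    \<open>r\<^sub>q \<le> q zq\<close>.\<close>
  have GN_iff: "solves_GN K (r\<^sub>p - pt zt_old) J zt_old zq_old q r\<^sub>q dt dq \<longleftrightarrow>
      dt \<in> carrier_vec m\<^sub>t \<and> dq \<in> carrier_vec m\<^sub>q \<and> r\<^sub>q \<le> q (zq_old + dq) \<and>
      (\<forall>zt\<in>carrier_vec m\<^sub>t. \<forall>zq\<in>carrier_vec m\<^sub>q. r\<^sub>q \<le> q zq \<longrightarrow>
        W (Z (zt_old + dt) (zq_old + dq)) \<le> W (Z zt zq))" for dt dq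
  proof -
    \<comment> \<open>Translation by the old values is a bijection of each space, with subtraction
      as its inverse.\<close>
    have shift: "(\<forall>et\<in>carrier_vec m\<^sub>t. \<forall>eq\<in>carrier_vec m\<^sub>q. P (zt_old + et) (zq_old + eq)) \<longleftrightarrow>
      (\<forall>zt\<in>carrier_vec m\<^sub>t. \<forall>zq\<in>carrier_vec m\<^sub>q. P zt zq)" for P
    proof -
      have "zt_old + (zt - zt_old) = zt" "zt - zt_old \<in> carrier_vec m\<^sub>t"
        if "zt \<in> carrier_vec m\<^sub>t" for zt using that zt_old by auto
      moreover have "zq_old + (zq - zq_old) = zq" "zq - zq_old \<in> carrier_vec m\<^sub>q"
        if "zq \<in> carrier_vec m\<^sub>q" for zq using that zq_old by auto
      ultimately show ?thesis using zt_old zq_old by (metis add_carrier_vec)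
    qed
    have pow: "(W (Z (zt_old + dt) (zq_old + dq)))\<^sup>2 \<le> (W (Z (zt_old + et) (zq_old + eq)))\<^sup>2
      \<longleftrightarrow> W (Z (zt_old + dt) (zq_old + dq)) \<le> W (Z (zt_old + et) (zq_old + eq))"
      if "dt \<in> carrier_vec m\<^sub>t" "dq \<in> carrier_vec m\<^sub>q" "et \<in> carrier_vec m\<^sub>t" "eq \<in> carrier_vec m\<^sub>q"
      for et eq
      unfolding W_def K using that zt_old zq_old
      by (intro power_mono_iff weighted_norm_nonneg[OF \<Lambda> indep] Z) auto
    have dims: "dim_vec zt_old = m\<^sub>t" "dim_vec zq_old = m\<^sub>q" using zt_old zq_old by auto
    have "solves_GN K (r\<^sub>p - pt zt_old) J zt_old zq_old q r\<^sub>q dt dq \<longleftrightarrow>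
      dt \<in> carrier_vec m\<^sub>t \<and> dq \<in> carrier_vec m\<^sub>q \<and> r\<^sub>q \<le> q (zq_old + dq) \<and>
      (\<forall>et\<in>carrier_vec m\<^sub>t. \<forall>eq\<in>carrier_vec m\<^sub>q. r\<^sub>q \<le> q (zq_old + eq) \<longrightarrow>
        W (Z (zt_old + dt) (zq_old + dq)) \<le> W (Z (zt_old + et) (zq_old + eq)))"
      using residual pow unfolding dims
      by (force simp: solves_GN_def is_arg_min_def dims W_def[symmetric] not_less)
    also have "(\<forall>et\<in>carrier_vec m\<^sub>t. \<forall>eq\<in>carrier_vec m\<^sub>q. r\<^sub>q \<le> q (zq_old + eq) \<longrightarrow>
        W (Z (zt_old + dt) (zq_old + dq)) \<le> W (Z (zt_old + et) (zq_old + eq))) \<longleftrightarrow>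
      (\<forall>zt\<in>carrier_vec m\<^sub>t. \<forall>zq\<in>carrier_vec m\<^sub>q. r\<^sub>q \<le> q zq \<longrightarrow>
        W (Z (zt_old + dt) (zq_old + dq)) \<le> W (Z zt zq))"
      by (rule shift)
    finally show ?thesis .
  qed

  \<comment> \<open>Transfer of minimizers in both directions, and linear independence\<close>
  show ?thesis
  proof (intro conjI allI impI)
    fix dt dq z0 zt zq
    assume GN: "solves_GN K (r\<^sub>p - pt zt_old) J zt_old zq_old q r\<^sub>q dt dq"
      and zt: "zt = zt_old + dt" and zq: "zq = zq_old + dq" and z0: "z0 = b_old - J *\<^sub>v zt"
    have z: "zt \<in> carrier_vec m\<^sub>t" "zq \<in> carrier_vec m\<^sub>q"
      using GN zt_old zq_old by (auto simp: GN_iff zt zq)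
    let ?P = "\<lambda>s. s \<in> H \<and> apply_vec L\<^sub>0 s = z0 \<and> apply_vec L\<^sub>t s = zt \<and> apply_vec L\<^sub>q s = zq"
    have P: "?P s \<longleftrightarrow> s \<in> H \<and> apply_vec \<Lambda> s = Z zt zq" for s
      using interp_iff[OF z] z0 by auto
    obtain s where s: "s \<in> H" "apply_vec \<Lambda> s = Z zt zq" "hnorm ip s = W (Z zt zq)"
      "\<And>s'. s' \<in> H \<Longrightarrow> apply_vec \<Lambda> s' = Z zt zq \<Longrightarrow> s' \<noteq> s \<Longrightarrow> hnorm ip s < hnorm ip s'"
      using interp[OF z] by blast
    \<comment> \<open>The strict inequality for every other interpolant makes \<open>s\<close> the
      only minimizer.\<close>
    have min_iff: "is_arg_min (hnorm ip) ?P s' \<longleftrightarrow> s' = s" for s'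
      unfolding P is_arg_min_def using s by (metis less_asym)
    then show "\<exists>!s. is_arg_min (hnorm ip) ?P s" by simp
    fix s'
    assume "is_arg_min (hnorm ip) ?P s'"
    then have "s' = s" by (simp add: min_iff)
    moreover have "solves_L H ip L_lin b_old L\<^sub>q q r\<^sub>q s"
    proof -
      have vals: "apply_vec L\<^sub>t s = zt" "apply_vec L\<^sub>q s = zq" using s(2) interp_iff[OF z] by auto
      \<comment> \<open>The values of a feasible \<open>u\<close> compete in the Gauss-Newton
        problem, and their weighted norm is at most the norm of \<open>u\<close>.\<close>
      have "hnorm ip s \<le> hnorm ip u"
        if u: "u \<in> H" "apply_vec L_lin u = b_old" "r\<^sub>q \<le> q (apply_vec L\<^sub>q u)" for u
      proof -
        have "hnorm ip s \<le> W (Z (apply_vec L\<^sub>t u) (apply_vec L\<^sub>q u))"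
          using GN u(3) apply_vec_carrier[OF Lt] apply_vec_carrier[OF Lq]
          by (simp add: GN_iff s(3) zt zq)
        also have "\<dots> \<le> hnorm ip u" using W_le[OF u(1)] u(2) by (simp add: feasible_iff)
        finally show ?thesis .
      qed
      then show ?thesis
        using s(1,2) vals GN by (auto simp: solves_L_def is_arg_min_def feasible_iff GN_iff zq not_less)
    qed
    ultimately show "solves_L H ip L_lin b_old L\<^sub>q q r\<^sub>q s'" by simp
  next
    fix s
    assume "solves_L H ip L_lin b_old L\<^sub>q q r\<^sub>q s"
    then have s: "s \<in> H" "apply_vec L_lin s = b_old" "r\<^sub>q \<le> q (apply_vec L\<^sub>q s)"
      and min: "\<And>u. u \<in> H \<Longrightarrow> apply_vec L_lin u = b_old \<Longrightarrow> r\<^sub>q \<le> q (apply_vec L\<^sub>q u) \<Longrightarrow>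
        hnorm ip s \<le> hnorm ip u"
      by (auto simp: solves_L_def is_arg_min_def not_less)
    have vals: "apply_vec L\<^sub>t s \<in> carrier_vec m\<^sub>t" "apply_vec L\<^sub>q s \<in> carrier_vec m\<^sub>q"
      using Lt Lq by (auto intro: apply_vec_carrier)
    have old: "zt_old + (apply_vec L\<^sub>t s - zt_old) = apply_vec L\<^sub>t s"
      "zq_old + (apply_vec L\<^sub>q s - zq_old) = apply_vec L\<^sub>q s"
      using vals zt_old zq_old by auto
    \<comment> \<open>The minimal interpolant \<open>u\<close> of a competing data vector is
      feasible for the recovery problem. The chain is: weighted norm of the data of
      \<open>s\<close>, norm of \<open>s\<close>, norm of \<open>u\<close>, weighted norm of the
      competing data.\<close>
    have "W (Z (apply_vec L\<^sub>t s) (apply_vec L\<^sub>q s)) \<le> W (Z zt zq)"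
      if z: "zt \<in> carrier_vec m\<^sub>t" "zq \<in> carrier_vec m\<^sub>q" and q: "r\<^sub>q \<le> q zq" for zt zq
    proof -
      obtain u where u: "u \<in> H" "apply_vec \<Lambda> u = Z zt zq" "hnorm ip u = W (Z zt zq)"
        using interp[OF z] by blast
      have "apply_vec L\<^sub>t u = zt" "apply_vec L\<^sub>q u = zq" using u(2) interp_iff[OF z] by auto
      then have "hnorm ip s \<le> W (Z zt zq)" using min[OF u(1)] u q by (simp add: feasible_iff)
      then show ?thesis using W_le[OF s(1)] s(2) by (simp add: feasible_iff)
    qed
    then show "solves_GN K (r\<^sub>p - pt zt_old) J zt_old zq_old q r\<^sub>q
        (apply_vec L\<^sub>t s - zt_old) (apply_vec L\<^sub>q s - zq_old)"
      using s(3) vals zt_old zq_old by (simp add: GN_iff old)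
  next
    show "lin_indep_on H (L_lin @\<^sub>v L\<^sub>q)"
      using lin_indep_on_add_mat_functionals[OF indep[unfolded \<Lambda>_def] carriers J] assms by simp
  qed
qed

end
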